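(* Let $\mathcal D$ be a finite non-empty hereditarily finite set. For every formula $\varphi$ of $\mathrm{FSO}_{\mathcal D}$, the theory $\mathrm{FSO}^0_{\mathcal D}$ proves $$\forall x\big[\forall y\,(y<x\to\varphi(y))\to\varphi(x)\big]\ \longrightarrow\ \forall x\,\varphi(x).$$
   Context: Language of $\mathrm{FSO}_{\mathcal D}$: HF-terms $K::=k\mid\dot\kappa\mid\dot g_{n,m}(K_1,\dots,K_n)$ ($k$ HF-variables, $\kappa$ hereditarily finite sets, $(n,m)\in\mathbb N^2$); Individual terms $t::=x\mid\mathsf{Root}\mid\mathsf S_d(t)$ ($d\in\mathcal D$); Function variables $F$; formulas $t\doteq u,t<u,K\doteq L,K\in L,K\subseteq L,F(t)\doteq K$ closed under $\lor,\neg,\exists x,\exists F{:}K,\exists k\in L,\exists k\subseteq L$; $t\le u:=t<u\lor t\doteq u$; $(F{:}K):=\forall x\exists k\in K\,F(x)\doteq k$. $\mathrm{FSO}^0_{\mathcal D}$ consists of the deduction rules of FSO — classical propositional natural deduction (excluded middle, axiom, ex falso, $\lor$-introduction/elimination), rules for $\exists x$, $\exists F{:}K$ (introduction from $\varphi[G/F]$ and $(G{:}K)$; elimination with extra hypothesis $(F{:}K)$), bounded HF quantifiers $\exists k\lhd L$ (introduction needs $K\lhd L$, elimination adds $k\lhd K$), and the substitution rule from $\Phi\vdash\varphi$ to $\Phi[F(t)/k]\vdash\varphi[F(t)/k]$ — together with: equality axioms ($\forall x\,x\doteq x$, $\forall x\forall y(x\doteq y\to\varphi[x/z]\to\varphi[y/z])$,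 $K\doteq K$, $K\doteq L\to\varphi[K/m]\to\varphi[L/m]$); the induction scheme $\varphi(\mathsf{Root})\to\bigwedge_{d\in\mathcal D}\forall x(\varphi(x)\to\varphi(\mathsf S_d(x)))\to\forall x\varphi(x)$ for every formula; and the tree axioms $\neg\exists x\bigvee_{d\ne d'}\mathsf S_d(x)\doteq\mathsf S_{d'}(x)$, $\forall x\forall y\bigwedge_d(\mathsf S_d(x)\doteq\mathsf S_d(y)\to x\doteq y)$, $\neg\exists x\,x<x$, $\forall x\forall y\forall z(x<y\to y<z\to x<z)$, $\forall x\,\mathsf{Root}\le x$, $\forall x\forall y\bigwedge_d(x<\mathsf S_d(y)\leftrightarrow x\le y)$. *)

theory Defs
  imports "HOL-Library.FSet"
begin

text \<open>Hereditarily finite sets. Since finite sets of type \<open>fset\<close> are extensional,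
  so is this datatype.\<close>

datatype hf = HF (elts: "hf fset")

text \<open>All variables are de Bruijn indices. The three sorts of variables (individual, HF and
  function variables) are numbered independently, so a binder of one sort does not affect the
  indices of the other two.\<close>

datatype itm = IVar nat | Root | Succ hf itm

text \<open>\<open>HApp m Ks\<close> is the application of the function symbol \<open>g\<close> with index
  \<open>(n, m)\<close> where \<open>n = length Ks\<close>; arities are thus correct by construction.\<close>

datatype htm = HVar nat | HConst hf | HApp nat "htm list"

text \<open>\<open>FEq F t K\<close> is \<open>F(t) = K\<close>. In \<open>ExF K \<phi>\<close>, \<open>ExIn L \<phi>\<close>, \<open>ExSub L \<phi>\<close>
  the bound \<open>K\<close> or \<open>L\<close> lies outside the scope of the binder.\<close>

datatype fm =
    IEq itm itm
  | Less itm itm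
  | HEq htm htm
  | HIn htm htm
  | HSub htm htm
  | FEq nat itm htm
  | Or fm fm
  | Neg fm
  | ExI fm
  | ExF htm fm
  | ExIn htm fm
  | ExSub htm fm

text \<open>Terms and formulas over the set of directions \<open>D\<close>: every successor symbol
  \<open>Succ d\<close> has \<open>d\<close> in \<open>D\<close>.\<close>

primrec is_itm :: "hf \<Rightarrow> itm \<Rightarrow> bool" where
  "is_itm D (IVar n) \<longleftrightarrow> True"
| "is_itm D Root \<longleftrightarrow> True"
| "is_itm D (Succ d t) \<longleftrightarrow> d |\<in>| elts D \<and> is_itm D t"

primrec is_fm :: "hf \<Rightarrow> fm \<Rightarrow> bool" where
  "is_fm D (IEq t u) \<longleftrightarrow> is_itm D t \<and> is_itm D u"
| "is_fm D (Less t u) \<longleftrightarrow> is_itm D t \<and> is_itm D u"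
| "is_fm D (HEq K L) \<longleftrightarrow> True"
| "is_fm D (HIn K L) \<longleftrightarrow> True"
| "is_fm D (HSub K L) \<longleftrightarrow> True"
| "is_fm D (FEq F t K) \<longleftrightarrow> is_itm D t"
| "is_fm D (Or \<phi> \<psi>) \<longleftrightarrow> is_fm D \<phi> \<and> is_fm D \<psi>"
| "is_fm D (Neg \<phi>) \<longleftrightarrow> is_fm D \<phi>"
| "is_fm D (ExI \<phi>) \<longleftrightarrow> is_fm D \<phi>"
| "is_fm D (ExF K \<phi>) \<longleftrightarrow> is_fm D \<phi>"
| "is_fm D (ExIn L \<phi>) \<longleftrightarrow> is_fm D \<phi>"
| "is_fm D (ExSub L \<phi>) \<longleftrightarrow> is_fm D \<phi>"

definition Imp :: "fm \<Rightarrow> fm \<Rightarrow> fm" where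
  "Imp \<phi> \<psi> = Or (Neg \<phi>) \<psi>"

definition And :: "fm \<Rightarrow> fm \<Rightarrow> fm" where
  "And \<phi> \<psi> = Neg (Or (Neg \<phi>) (Neg \<psi>))"

definition Iff :: "fm \<Rightarrow> fm \<Rightarrow> fm" where
  "Iff \<phi> \<psi> = And (Imp \<phi> \<psi>) (Imp \<psi> \<phi>)"

definition Top :: fm where
  "Top = Or (IEq Root Root) (Neg (IEq Root Root))"

definition Bot :: fm where
  "Bot = Neg Top"

definition AllI :: "fm \<Rightarrow> fm" where
  "AllI \<phi> = Neg (ExI (Neg \<phi>))"

definition Leq :: "itm \<Rightarrow> itm \<Rightarrow> fm" where
  "Leq t u = Or (Less t u) (IEq t u)"

definition Ftype :: "nat \<Rightarrow> htm \<Rightarrow> fm" where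
  "Ftype F K = AllI (ExIn K (FEq F (IVar 0) (HVar 0)))"

fun Conj :: "fm list \<Rightarrow> fm" where
  "Conj [] = Top"
| "Conj [\<phi>] = \<phi>"
| "Conj (\<phi> # \<psi> # \<phi>s) = And \<phi> (Conj (\<psi> # \<phi>s))"

fun Disj :: "fm list \<Rightarrow> fm" where
  "Disj [] = Bot"
| "Disj [\<phi>] = \<phi>"
| "Disj (\<phi> # \<psi> # \<phi>s) = Or \<phi> (Disj (\<psi> # \<phi>s))"

text \<open>Conjunctions and disjunctions indexed by a finite set are taken in an arbitrary but
  fixed order of the index set.\<close>

definition enum_set :: "'a set \<Rightarrow> 'a list" where
  "enum_set A = (SOME xs. set xs = A \<and> distinct xs)"

definition BigAnd :: "'a set \<Rightarrow> ('a \<Rightarrow> fm) \<Rightarrow> fm" where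
  "BigAnd A f = Conj (map f (enum_set A))"

definition BigOr :: "'a set \<Rightarrow> ('a \<Rightarrow> fm) \<Rightarrow> fm" where
  "BigOr A f = Disj (map f (enum_set A))"

primrec isubst_t :: "(nat \<Rightarrow> itm) \<Rightarrow> itm \<Rightarrow> itm" where
  "isubst_t \<sigma> (IVar n) = \<sigma> n"
| "isubst_t \<sigma> Root = Root"
| "isubst_t \<sigma> (Succ d t) = Succ d (isubst_t \<sigma> t)"

definition ishift_t :: "itm \<Rightarrow> itm" where
  "ishift_t = isubst_t (\<lambda>n. IVar (Suc n))"

definition iup :: "(nat \<Rightarrow> itm) \<Rightarrow> nat \<Rightarrow> itm" where
  "iup \<sigma> = case_nat (IVar 0) (\<lambda>n. ishift_t (\<sigma> n))"

primrec isubst :: "(nat \<Rightarrow> itm) \<Rightarrow> fm \<Rightarrow> fm" where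
  "isubst \<sigma> (IEq t u) = IEq (isubst_t \<sigma> t) (isubst_t \<sigma> u)"
| "isubst \<sigma> (Less t u) = Less (isubst_t \<sigma> t) (isubst_t \<sigma> u)"
| "isubst \<sigma> (HEq K L) = HEq K L"
| "isubst \<sigma> (HIn K L) = HIn K L"
| "isubst \<sigma> (HSub K L) = HSub K L"
| "isubst \<sigma> (FEq F t K) = FEq F (isubst_t \<sigma> t) K"
| "isubst \<sigma> (Or \<phi> \<psi>) = Or (isubst \<sigma> \<phi>) (isubst \<sigma> \<psi>)"
| "isubst \<sigma> (Neg \<phi>) = Neg (isubst \<sigma> \<phi>)"
| "isubst \<sigma> (ExI \<phi>) = ExI (isubst (iup \<sigma>) \<phi>)"
| "isubst \<sigma> (ExF K \<phi>) = ExF K (isubst \<sigma> \<phi>)"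
| "isubst \<sigma> (ExIn L \<phi>) = ExIn L (isubst \<sigma> \<phi>)"
| "isubst \<sigma> (ExSub L \<phi>) = ExSub L (isubst \<sigma> \<phi>)"

definition ishift :: "fm \<Rightarrow> fm" where
  "ishift = isubst (\<lambda>n. IVar (Suc n))"

text \<open>\<open>iinst j t \<phi>\<close> is \<open>\<phi>(t)\<close>, where \<open>\<phi>\<close> is regarded as a formula \<open>\<phi>(x)\<close> in its
  individual variable \<open>0\<close>, written below \<open>j\<close> additional individual binders whose variables
  do not occur in \<open>\<phi>\<close> (they may occur in \<open>t\<close>).\<close>

definition iinst :: "nat \<Rightarrow> itm \<Rightarrow> fm \<Rightarrow> fm" where
  "iinst j t = isubst (case_nat t (\<lambda>n. IVar (n + j)))"

primrec hsubst_t :: "(nat \<Rightarrow> htm) \<Rightarrow> htm \<Rightarrow> htm" where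
  "hsubst_t \<sigma> (HVar n) = \<sigma> n"
| "hsubst_t \<sigma> (HConst a) = HConst a"
| "hsubst_t \<sigma> (HApp m Ks) = HApp m (map (hsubst_t \<sigma>) Ks)"

definition hshift_t :: "htm \<Rightarrow> htm" where
  "hshift_t = hsubst_t (\<lambda>n. HVar (Suc n))"

definition hup :: "(nat \<Rightarrow> htm) \<Rightarrow> nat \<Rightarrow> htm" where
  "hup \<sigma> = case_nat (HVar 0) (\<lambda>n. hshift_t (\<sigma> n))"

primrec hsubst :: "(nat \<Rightarrow> htm) \<Rightarrow> fm \<Rightarrow> fm" where
  "hsubst \<sigma> (IEq t u) = IEq t u"
| "hsubst \<sigma> (Less t u) = Less t u"
| "hsubst \<sigma> (HEq K L) = HEq (hsubst_t \<sigma> K) (hsubst_t \<sigma> L)"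
| "hsubst \<sigma> (HIn K L) = HIn (hsubst_t \<sigma> K) (hsubst_t \<sigma> L)"
| "hsubst \<sigma> (HSub K L) = HSub (hsubst_t \<sigma> K) (hsubst_t \<sigma> L)"
| "hsubst \<sigma> (FEq F t K) = FEq F t (hsubst_t \<sigma> K)"
| "hsubst \<sigma> (Or \<phi> \<psi>) = Or (hsubst \<sigma> \<phi>) (hsubst \<sigma> \<psi>)"
| "hsubst \<sigma> (Neg \<phi>) = Neg (hsubst \<sigma> \<phi>)"
| "hsubst \<sigma> (ExI \<phi>) = ExI (hsubst \<sigma> \<phi>)"
| "hsubst \<sigma> (ExF K \<phi>) = ExF (hsubst_t \<sigma> K) (hsubst \<sigma> \<phi>)"
| "hsubst \<sigma> (ExIn L \<phi>) = ExIn (hsubst_t \<sigma> L) (hsubst (hup \<sigma>) \<phi>)"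
| "hsubst \<sigma> (ExSub L \<phi>) = ExSub (hsubst_t \<sigma> L) (hsubst (hup \<sigma>) \<phi>)"

definition hshift :: "fm \<Rightarrow> fm" where
  "hshift = hsubst (\<lambda>n. HVar (Suc n))"

definition hinst :: "htm \<Rightarrow> fm \<Rightarrow> fm" where
  "hinst K = hsubst (case_nat K HVar)"

definition fup :: "(nat \<Rightarrow> nat) \<Rightarrow> nat \<Rightarrow> nat" where
  "fup \<rho> = case_nat 0 (\<lambda>n. Suc (\<rho> n))"

primrec fren :: "(nat \<Rightarrow> nat) \<Rightarrow> fm \<Rightarrow> fm" where
  "fren \<rho> (IEq t u) = IEq t u"
| "fren \<rho> (Less t u) = Less t u"
| "fren \<rho> (HEq K L) = HEq K L"
| "fren \<rho> (HIn K L) = HIn K L"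
| "fren \<rho> (HSub K L) = HSub K L"
| "fren \<rho> (FEq F t K) = FEq (\<rho> F) t K"
| "fren \<rho> (Or \<phi> \<psi>) = Or (fren \<rho> \<phi>) (fren \<rho> \<psi>)"
| "fren \<rho> (Neg \<phi>) = Neg (fren \<rho> \<phi>)"
| "fren \<rho> (ExI \<phi>) = ExI (fren \<rho> \<phi>)"
| "fren \<rho> (ExF K \<phi>) = ExF K (fren (fup \<rho>) \<phi>)"
| "fren \<rho> (ExIn L \<phi>) = ExIn L (fren \<rho> \<phi>)"
| "fren \<rho> (ExSub L \<phi>) = ExSub L (fren \<rho> \<phi>)"

definition fshift :: "fm \<Rightarrow> fm" where
  "fshift = fren Suc"

definition finst :: "nat \<Rightarrow> fm \<Rightarrow> fm" where
  "finst G = fren (case_nat G (\<lambda>n. n))"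

text \<open>\<open>F(t)\<close> is not an HF-term, so \<open>\<phi>[F(t)/k]\<close> is a formula only for some \<open>\<phi>\<close>. It is
  defined if every free occurrence of \<open>k\<close> is one side of an equation, or the left-hand side of a
  membership or inclusion, whose other side is an HF-term without \<open>k\<close>. The equation
  becomes \<open>F(t) = L\<close>; \<open>F(t) \<in> L\<close> and \<open>F(t) \<subseteq> L\<close> stand for
  \<open>\<exists>m\<in>L. F(t) = m\<close> and \<open>\<exists>m\<subseteq>L. F(t) = m\<close>, as in \<open>F : L\<close>. By the HF equality axioms
  \<open>k \<in> L\<close>, \<open>k \<subseteq> L\<close> and \<open>L = k\<close> are provably equivalent to \<open>\<exists>m\<in>L. k = m\<close>,
  \<open>\<exists>m\<subseteq>L. k = m\<close> and \<open>k = L\<close>, so the rule has the same strength as its restriction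
  to occurrences of the form \<open>k = L\<close>. Other occurrences, such as \<open>L \<in> F(t)\<close> or
  \<open>G(u) = F(t)\<close>, have no counterpart in the language.

  The index \<open>k\<close> is treated as a name here: no other index is renumbered.\<close>

primrec hvars :: "htm \<Rightarrow> nat set" where
  "hvars (HVar n) = {n}"
| "hvars (HConst a) = {}"
| "hvars (HApp m Ks) = \<Union> (set (map hvars Ks))"

primrec fsubst_ok :: "nat \<Rightarrow> fm \<Rightarrow> bool" where
  "fsubst_ok k (IEq t u) \<longleftrightarrow> True"
| "fsubst_ok k (Less t u) \<longleftrightarrow> True"
| "fsubst_ok k (HEq K L) \<longleftrightarrow>
     (k \<in> hvars K \<longrightarrow> K = HVar k \<and> k \<notin> hvars L) \<and>
     (k \<in> hvars L \<longrightarrow> L = HVar k \<and> k \<notin> hvars K)"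
| "fsubst_ok k (HIn K L) \<longleftrightarrow> (k \<in> hvars K \<longrightarrow> K = HVar k) \<and> k \<notin> hvars L"
| "fsubst_ok k (HSub K L) \<longleftrightarrow> (k \<in> hvars K \<longrightarrow> K = HVar k) \<and> k \<notin> hvars L"
| "fsubst_ok k (FEq G u K) \<longleftrightarrow> k \<notin> hvars K"
| "fsubst_ok k (Or \<phi> \<psi>) \<longleftrightarrow> fsubst_ok k \<phi> \<and> fsubst_ok k \<psi>"
| "fsubst_ok k (Neg \<phi>) \<longleftrightarrow> fsubst_ok k \<phi>"
| "fsubst_ok k (ExI \<phi>) \<longleftrightarrow> fsubst_ok k \<phi>"
| "fsubst_ok k (ExF K \<phi>) \<longleftrightarrow> k \<notin> hvars K \<and> fsubst_ok k \<phi>"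
| "fsubst_ok k (ExIn L \<phi>) \<longleftrightarrow> k \<notin> hvars L \<and> fsubst_ok (Suc k) \<phi>"
| "fsubst_ok k (ExSub L \<phi>) \<longleftrightarrow> k \<notin> hvars L \<and> fsubst_ok (Suc k) \<phi>"

primrec fsubst :: "nat \<Rightarrow> nat \<Rightarrow> itm \<Rightarrow> fm \<Rightarrow> fm" where
  "fsubst k F t (IEq u v) = IEq u v"
| "fsubst k F t (Less u v) = Less u v"
| "fsubst k F t (HEq K L) =
     (if K = HVar k then FEq F t L else if L = HVar k then FEq F t K else HEq K L)"
| "fsubst k F t (HIn K L) =
     (if K = HVar k then ExIn L (FEq F t (HVar 0)) else HIn K L)"
| "fsubst k F t (HSub K L) =
     (if K = HVar k then ExSub L (FEq F t (HVar 0)) else HSub K L)"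
| "fsubst k F t (FEq G u K) = FEq G u K"
| "fsubst k F t (Or \<phi> \<psi>) = Or (fsubst k F t \<phi>) (fsubst k F t \<psi>)"
| "fsubst k F t (Neg \<phi>) = Neg (fsubst k F t \<phi>)"
| "fsubst k F t (ExI \<phi>) = ExI (fsubst k F (ishift_t t) \<phi>)"
| "fsubst k F t (ExF K \<phi>) = ExF K (fsubst k (Suc F) t \<phi>)"
| "fsubst k F t (ExIn L \<phi>) = ExIn L (fsubst (Suc k) F t \<phi>)"
| "fsubst k F t (ExSub L \<phi>) = ExSub L (fsubst (Suc k) F t \<phi>)"

text \<open>In \<open>eq_subst\<close> the formula \<open>\<phi>\<close> has \<open>z\<close> as variable \<open>0\<close> and lies in the scope of
  \<open>\<forall>x\<forall>y\<close>, so \<open>x\<close> and \<open>y\<close> may occur in it.\<close>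

inductive fso0_axiom :: "hf \<Rightarrow> fm \<Rightarrow> bool" for D :: hf where
  eq_refl: "fso0_axiom D (AllI (IEq (IVar 0) (IVar 0)))"
| eq_subst: "fso0_axiom D
    (AllI (AllI (Imp (IEq (IVar 1) (IVar 0))
      (Imp (iinst 0 (IVar 1) \<phi>) (iinst 0 (IVar 0) \<phi>)))))"
| heq_refl: "fso0_axiom D (HEq K K)"
| heq_subst: "fso0_axiom D (Imp (HEq K L) (Imp (hinst K \<phi>) (hinst L \<phi>)))"
| induction: "fso0_axiom D
    (Imp (iinst 0 Root \<phi>)
      (Imp (BigAnd (fset (elts D)) (\<lambda>d. AllI (Imp \<phi> (iinst 1 (Succ d (IVar 0)) \<phi>))))
        (AllI \<phi>)))"
| succ_disjoint: "fso0_axiom D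
    (Neg (ExI (BigOr {(d, d'). d |\<in>| elts D \<and> d' |\<in>| elts D \<and> d \<noteq> d'}
      (\<lambda>(d, d'). IEq (Succ d (IVar 0)) (Succ d' (IVar 0))))))"
| succ_inj: "fso0_axiom D
    (AllI (AllI (BigAnd (fset (elts D))
      (\<lambda>d. Imp (IEq (Succ d (IVar 1)) (Succ d (IVar 0))) (IEq (IVar 1) (IVar 0))))))"
| less_irrefl: "fso0_axiom D (Neg (ExI (Less (IVar 0) (IVar 0))))"
| less_trans: "fso0_axiom D
    (AllI (AllI (AllI (Imp (Less (IVar 2) (IVar 1))
      (Imp (Less (IVar 1) (IVar 0)) (Less (IVar 2) (IVar 0)))))))"
| root_least: "fso0_axiom D (AllI (Leq Root (IVar 0)))"
| less_succ: "fso0_axiom D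
    (AllI (AllI (BigAnd (fset (elts D))
      (\<lambda>d. Iff (Less (IVar 1) (Succ d (IVar 0))) (Leq (IVar 1) (IVar 0))))))"

text \<open>The \<open>is_fm\<close> and \<open>is_itm\<close> premises confine derivations to the language over \<open>D\<close>.
  Eigenvariable conditions are expressed by shifting the context and the conclusion.\<close>

inductive fso0 :: "hf \<Rightarrow> fm list \<Rightarrow> fm \<Rightarrow> bool" for D :: hf where
  theory_axiom: "\<lbrakk>fso0_axiom D \<phi>; \<forall>\<chi>\<in>set (\<phi> # \<Phi>). is_fm D \<chi>\<rbrakk> \<Longrightarrow> fso0 D \<Phi> \<phi>"
| assumption: "\<lbrakk>\<phi> \<in> set \<Phi>; \<forall>\<chi>\<in>set \<Phi>. is_fm D \<chi>\<rbrakk> \<Longrightarrow> fso0 D \<Phi> \<phi>"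
| excluded_middle: "\<forall>\<chi>\<in>set (\<phi> # \<Phi>). is_fm D \<chi> \<Longrightarrow> fso0 D \<Phi> (Or \<phi> (Neg \<phi>))"
| ex_falso: "\<lbrakk>fso0 D \<Phi> \<phi>; fso0 D \<Phi> (Neg \<phi>); is_fm D \<psi>\<rbrakk> \<Longrightarrow> fso0 D \<Phi> \<psi>"
| Or_intro1: "\<lbrakk>fso0 D \<Phi> \<phi>; is_fm D \<psi>\<rbrakk> \<Longrightarrow> fso0 D \<Phi> (Or \<phi> \<psi>)"
| Or_intro2: "\<lbrakk>fso0 D \<Phi> \<psi>; is_fm D \<phi>\<rbrakk> \<Longrightarrow> fso0 D \<Phi> (Or \<phi> \<psi>)"
| Or_elim: "\<lbrakk>fso0 D \<Phi> (Or \<phi> \<psi>); fso0 D (\<phi> # \<Phi>) \<chi>; fso0 D (\<psi> # \<Phi>) \<chi>\<rbrakk>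
    \<Longrightarrow> fso0 D \<Phi> \<chi>"
| ExI_intro: "\<lbrakk>fso0 D \<Phi> (iinst 0 t \<phi>); is_itm D t\<rbrakk> \<Longrightarrow> fso0 D \<Phi> (ExI \<phi>)"
| ExI_elim: "\<lbrakk>fso0 D \<Phi> (ExI \<phi>); fso0 D (\<phi> # map ishift \<Phi>) (ishift \<psi>)\<rbrakk> \<Longrightarrow> fso0 D \<Phi> \<psi>"
| ExF_intro: "\<lbrakk>fso0 D \<Phi> (finst G \<phi>); fso0 D \<Phi> (Ftype G K)\<rbrakk> \<Longrightarrow> fso0 D \<Phi> (ExF K \<phi>)"
| ExF_elim: "\<lbrakk>fso0 D \<Phi> (ExF K \<phi>); fso0 D (\<phi> # Ftype 0 K # map fshift \<Phi>) (fshift \<psi>)\<rbrakk>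
    \<Longrightarrow> fso0 D \<Phi> \<psi>"
| ExIn_intro: "\<lbrakk>fso0 D \<Phi> (hinst K \<phi>); fso0 D \<Phi> (HIn K L)\<rbrakk> \<Longrightarrow> fso0 D \<Phi> (ExIn L \<phi>)"
| ExIn_elim: "\<lbrakk>fso0 D \<Phi> (ExIn L \<phi>);
      fso0 D (\<phi> # HIn (HVar 0) (hshift_t L) # map hshift \<Phi>) (hshift \<psi>)\<rbrakk>
    \<Longrightarrow> fso0 D \<Phi> \<psi>"
| ExSub_intro: "\<lbrakk>fso0 D \<Phi> (hinst K \<phi>); fso0 D \<Phi> (HSub K L)\<rbrakk> \<Longrightarrow> fso0 D \<Phi> (ExSub L \<phi>)"
| ExSub_elim: "\<lbrakk>fso0 D \<Phi> (ExSub L \<phi>);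
      fso0 D (\<phi> # HSub (HVar 0) (hshift_t L) # map hshift \<Phi>) (hshift \<psi>)\<rbrakk>
    \<Longrightarrow> fso0 D \<Phi> \<psi>"
| substitution: "\<lbrakk>fso0 D \<Phi> \<phi>; \<forall>\<chi>\<in>set (\<phi> # \<Phi>). fsubst_ok k \<chi>; is_itm D t\<rbrakk>
    \<Longrightarrow> fso0 D (map (fsubst k F t) \<Phi>) (fsubst k F t \<phi>)"

end

(* Well-founded induction for phi is plain induction for psi(x) = "phi(y) for all y < x".
   The progressiveness hypothesis is exactly "psi(x) implies phi(x) for all x"; nothing lies
   below the root, and everything below S_d(x) is either below x, where psi(x) applies, or
   equal to x, where psi(x) gives phi(x). *)

theory Submission
  imports Defs
begin

section \<open>Individual substitutions\<close>

lemma iup_simps [simp]: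
  "iup \<sigma> 0 = IVar 0"
  "iup \<sigma> (Suc n) = ishift_t (\<sigma> n)"
  by (simp_all add: iup_def)

lemma isubst_t_comp: "isubst_t \<sigma> (isubst_t \<tau> t) = isubst_t (\<lambda>n. isubst_t \<sigma> (\<tau> n)) t"
  by (induction t) auto

lemma isubst_t_IVar [simp]: "isubst_t IVar t = t"
  by (induction t) auto

text \<open>A shifted term never mentions index 0, so whatever the substitution puts there is
  discarded; this is how instantiation cancels a shift.\<close>

lemma isubst_t_ishift_t [simp]: "isubst_t \<sigma> (ishift_t t) = isubst_t (\<lambda>n. \<sigma> (Suc n)) t"
  by (simp add: ishift_t_def isubst_t_comp)

lemma ishift_t_simps [simp]:
  "ishift_t (IVar n) = IVar (Suc n)"
  "ishift_t Root = Root"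
  "ishift_t (Succ d t) = Succ d (ishift_t t)"
  by (simp_all add: ishift_t_def)

lemma ishift_t_isubst_t: "ishift_t (isubst_t \<sigma> t) = isubst_t (\<lambda>n. ishift_t (\<sigma> n)) t"
  by (simp add: ishift_t_def isubst_t_comp)

lemma iup_IVar [simp]: "iup IVar = IVar"
  by (rule ext) (simp add: iup_def split: nat.split)

text \<open>Supplies the \<open>ExI\<close> case of composition on formulas: both lifts fix index 0,
  and at the other indices shifting commutes with substitution.\<close>

lemma iup_comp: "(\<lambda>n. isubst_t (iup \<sigma>) (iup \<tau> n)) = iup (\<lambda>n. isubst_t \<sigma> (\<tau> n))"
  by (rule ext) (simp add: iup_def ishift_t_isubst_t split: nat.split)

text \<open>Reduces equalities between instantiated formulas to equalities between functions from
  indices to terms.\<close>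

lemma isubst_comp: "isubst \<sigma> (isubst \<tau> \<phi>) = isubst (\<lambda>n. isubst_t \<sigma> (\<tau> n)) \<phi>"
  by (induction \<phi> arbitrary: \<sigma> \<tau>) (simp_all add: isubst_t_comp iup_comp)

lemma isubst_IVar [simp]: "isubst IVar \<phi> = \<phi>"
  by (induction \<phi>) simp_all

lemma isubst_connectives [simp]:
  "isubst \<sigma> (Imp \<phi> \<psi>) = Imp (isubst \<sigma> \<phi>) (isubst \<sigma> \<psi>)"
  "isubst \<sigma> (And \<phi> \<psi>) = And (isubst \<sigma> \<phi>) (isubst \<sigma> \<psi>)"
  "isubst \<sigma> (Iff \<phi> \<psi>) = Iff (isubst \<sigma> \<phi>) (isubst \<sigma> \<psi>)"
  "isubst \<sigma> Top = Top"
  "isubst \<sigma> (AllI \<phi>) = AllI (isubst (iup \<sigma>) \<phi>)"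
  "isubst \<sigma> (Leq t u) = Leq (isubst_t \<sigma> t) (isubst_t \<sigma> u)"
  by (simp_all add: Imp_def And_def Iff_def Top_def AllI_def Leq_def)

lemma isubst_Conj: "isubst \<sigma> (Conj \<phi>s) = Conj (map (isubst \<sigma>) \<phi>s)"
  by (induction \<phi>s rule: Conj.induct) simp_all

text \<open>Substitution leaves the index set alone, so both sides use the same enumeration of
  \<open>A\<close>.\<close>

lemma isubst_BigAnd [simp]: "isubst \<sigma> (BigAnd A f) = BigAnd A (\<lambda>a. isubst \<sigma> (f a))"
  by (simp add: BigAnd_def isubst_Conj comp_def)

section \<open>Membership in the language over \<open>D\<close>\<close>

lemma is_itm_isubst_t: "is_itm D t \<Longrightarrow> (\<And>n. is_itm D (\<sigma> n)) \<Longrightarrow> is_itm D (isubst_t \<sigma> t)"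
  by (induction t) auto

lemma is_itm_ishift_t [simp]: "is_itm D (ishift_t t) \<longleftrightarrow> is_itm D t"
  by (induction t) auto

lemma is_itm_iup: "(\<And>n. is_itm D (\<sigma> n)) \<Longrightarrow> is_itm D (iup \<sigma> n)"
  by (cases n) simp_all

lemma is_fm_isubst: "is_fm D \<phi> \<Longrightarrow> (\<And>n. is_itm D (\<sigma> n)) \<Longrightarrow> is_fm D (isubst \<sigma> \<phi>)"
  by (induction \<phi> arbitrary: \<sigma>) (auto intro: is_itm_isubst_t is_itm_iup)

lemma is_fm_ishift: "is_fm D \<phi> \<Longrightarrow> is_fm D (ishift \<phi>)"
  by (simp add: ishift_def is_fm_isubst)

lemma is_fm_iinst: "is_fm D \<phi> \<Longrightarrow> is_itm D t \<Longrightarrow> is_fm D (iinst j t \<phi>)"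
  by (auto simp: iinst_def split: nat.split intro!: is_fm_isubst)

lemma is_fm_connectives [simp]:
  "is_fm D (Imp \<phi> \<psi>) \<longleftrightarrow> is_fm D \<phi> \<and> is_fm D \<psi>"
  "is_fm D (And \<phi> \<psi>) \<longleftrightarrow> is_fm D \<phi> \<and> is_fm D \<psi>"
  "is_fm D (Iff \<phi> \<psi>) \<longleftrightarrow> is_fm D \<phi> \<and> is_fm D \<psi>"
  "is_fm D Top"
  "is_fm D (AllI \<phi>) \<longleftrightarrow> is_fm D \<phi>"
  "is_fm D (Leq t u) \<longleftrightarrow> is_itm D t \<and> is_itm D u"
  by (auto simp: Imp_def And_def Iff_def Top_def AllI_def Leq_def)

lemma set_enum_set: "finite A \<Longrightarrow> set (enum_set A) = A"
  unfolding enum_set_def using someI_ex[OF finite_distinct_list] by blast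

lemma is_fm_Conj: "(\<And>\<phi>. \<phi> \<in> set \<phi>s \<Longrightarrow> is_fm D \<phi>) \<Longrightarrow> is_fm D (Conj \<phi>s)"
  by (induction \<phi>s rule: Conj.induct) simp_all

lemma is_fm_BigAnd: "finite A \<Longrightarrow> (\<And>a. a \<in> A \<Longrightarrow> is_fm D (f a)) \<Longrightarrow> is_fm D (BigAnd A f)"
  unfolding BigAnd_def by (rule is_fm_Conj) (auto simp: set_enum_set)

section \<open>Derived rules\<close>

text \<open>Quantifying over all larger contexts makes weakening immediate; for \<open>fso0\<close> itself it would
  need an induction through the substitution rule, whose side condition constrains the context.\<close>

definition entails :: "hf \<Rightarrow> fm set \<Rightarrow> fm \<Rightarrow> bool" where
  "entails D \<Gamma> \<phi> \<longleftrightarrow> is_fm D \<phi> \<and>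
     (\<forall>\<Phi>. \<Gamma> \<subseteq> set \<Phi> \<longrightarrow> (\<forall>\<chi>\<in>set \<Phi>. is_fm D \<chi>) \<longrightarrow> fso0 D \<Phi> \<phi>)"

lemma entails_is_fm: "entails D \<Gamma> \<phi> \<Longrightarrow> is_fm D \<phi>"
  by (simp add: entails_def)

lemma entails_mono: "entails D \<Gamma> \<phi> \<Longrightarrow> \<Gamma> \<subseteq> \<Delta> \<Longrightarrow> entails D \<Delta> \<phi>"
  unfolding entails_def by blast

lemma entails_axiom: "fso0_axiom D \<phi> \<Longrightarrow> is_fm D \<phi> \<Longrightarrow> entails D \<Gamma> \<phi>"
  by (simp add: entails_def fso0.theory_axiom)

lemma entails_assumption: "\<phi> \<in> \<Gamma> \<Longrightarrow> is_fm D \<phi> \<Longrightarrow> entails D \<Gamma> \<phi>"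
  by (auto simp: entails_def intro: fso0.assumption)

lemma entails_excluded_middle: "is_fm D \<phi> \<Longrightarrow> entails D \<Gamma> (Or \<phi> (Neg \<phi>))"
  by (simp add: entails_def fso0.excluded_middle)

lemma entails_ex_falso:
  "entails D \<Gamma> \<phi> \<Longrightarrow> entails D \<Gamma> (Neg \<phi>) \<Longrightarrow> is_fm D \<psi> \<Longrightarrow> entails D \<Gamma> \<psi>"
  by (auto simp: entails_def intro: fso0.ex_falso)

text \<open>The form in which refutations occur below: the negation is a hypothesis of the larger
  context, while the formula itself is already derivable in the smaller one.\<close>

lemma entails_contradiction:
  assumes "entails D \<Gamma> \<phi>" "Neg \<phi> \<in> \<Delta>" "\<Gamma> \<subseteq> \<Delta>" "is_fm D \<psi>"
  shows "entails D \<Delta> \<psi>"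
proof (rule entails_ex_falso)
  show "entails D \<Delta> \<phi>"
    using assms(1,3) by (rule entails_mono)
  show "entails D \<Delta> (Neg \<phi>)"
    using assms(2) entails_is_fm[OF assms(1)] by (simp add: entails_assumption)
qed fact

lemma entails_OrI1: "entails D \<Gamma> \<phi> \<Longrightarrow> is_fm D \<psi> \<Longrightarrow> entails D \<Gamma> (Or \<phi> \<psi>)"
  by (auto simp: entails_def intro: fso0.Or_intro1)

lemma entails_OrI2: "entails D \<Gamma> \<psi> \<Longrightarrow> is_fm D \<phi> \<Longrightarrow> entails D \<Gamma> (Or \<phi> \<psi>)"
  by (auto simp: entails_def intro: fso0.Or_intro2)

lemma entails_OrE:
  assumes "entails D \<Gamma> (Or \<phi> \<psi>)" "entails D (insert \<phi> \<Gamma>) \<chi>" "entails D (insert \<psi> \<Gamma>) \<chi>"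
  shows "entails D \<Gamma> \<chi>"
  unfolding entails_def
proof (intro conjI allI impI)
  show "is_fm D \<chi>"
    using assms(2) by (rule entails_is_fm)
  fix \<Phi>
  assume "\<Gamma> \<subseteq> set \<Phi>" "\<forall>\<chi>\<in>set \<Phi>. is_fm D \<chi>"
  \<comment> \<open>The extended contexts must stay within the language; for the disjuncts this is
    inherited from the derived disjunction.\<close>
  moreover have "is_fm D \<phi>" "is_fm D \<psi>"
    using entails_is_fm[OF assms(1)] by simp_all
  moreover have "insert \<phi> \<Gamma> \<subseteq> set (\<phi> # \<Phi>)" "insert \<psi> \<Gamma> \<subseteq> set (\<psi> # \<Phi>)"
    using \<open>\<Gamma> \<subseteq> set \<Phi>\<close> by auto
  ultimately have "fso0 D \<Phi> (Or \<phi> \<psi>)" "fso0 D (\<phi> # \<Phi>) \<chi>" "fso0 D (\<psi> # \<Phi>) \<chi>"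
    using assms unfolding entails_def by simp_all
  then show "fso0 D \<Phi> \<chi>"
    by (rule fso0.Or_elim)
qed

lemma entails_ExI_intro:
  "entails D \<Gamma> (iinst 0 t \<phi>) \<Longrightarrow> is_itm D t \<Longrightarrow> is_fm D \<phi> \<Longrightarrow> entails D \<Gamma> (ExI \<phi>)"
  by (auto simp: entails_def intro: fso0.ExI_intro)

lemma entails_ExI_elim:
  assumes "entails D \<Gamma> (ExI \<phi>)" "entails D (insert \<phi> (ishift ` \<Gamma>)) (ishift \<psi>)" "is_fm D \<psi>"
  shows "entails D \<Gamma> \<psi>"
  unfolding entails_def
proof (intro conjI allI impI)
  show "is_fm D \<psi>"
    by fact
  fix \<Phi>
  assume *: "\<Gamma> \<subseteq> set \<Phi>" "\<forall>\<chi>\<in>set \<Phi>. is_fm D \<chi>"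
  then have "insert \<phi> (ishift ` \<Gamma>) \<subseteq> set (\<phi> # map ishift \<Phi>)"
    by auto
  moreover have "\<forall>\<chi>\<in>set (\<phi> # map ishift \<Phi>). is_fm D \<chi>"
    using * entails_is_fm[OF assms(1)] by (auto intro: is_fm_ishift)
  ultimately have "fso0 D (\<phi> # map ishift \<Phi>) (ishift \<psi>)"
    using assms(2) unfolding entails_def by blast
  moreover have "fso0 D \<Phi> (ExI \<phi>)"
    using assms(1) * unfolding entails_def by blast
  ultimately show "fso0 D \<Phi> \<psi>"
    using fso0.ExI_elim by blast
qed

section \<open>Classical rules for the defined connectives\<close>

lemma entails_by_cases:
  assumes "is_fm D \<phi>" "entails D (insert \<phi> \<Gamma>) \<psi>" "entails D (insert (Neg \<phi>) \<Gamma>) \<psi>"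
  shows "entails D \<Gamma> \<psi>"
  using entails_OrE entails_excluded_middle assms by blast

text \<open>Implication abbreviates a disjunction, so a hypothesis is discharged by a case split on
  it: the positive case gives the right disjunct, the negative case the left one.\<close>

lemma entails_ImpI:
  assumes "entails D (insert \<phi> \<Gamma>) \<psi>" "is_fm D \<phi>"
  shows "entails D \<Gamma> (Imp \<phi> \<psi>)"
  unfolding Imp_def
proof (rule entails_by_cases)
  show "entails D (insert \<phi> \<Gamma>) (Or (Neg \<phi>) \<psi>)"
    using assms by (intro entails_OrI2) auto
  show "entails D (insert (Neg \<phi>) \<Gamma>) (Or (Neg \<phi>) \<psi>)"
    using assms by (intro entails_OrI1 entails_assumption) (auto dest: entails_is_fm)
qed fact

lemma entails_mp:
  assumes "entails D \<Gamma> (Imp \<phi> \<psi>)" "entails D \<Gamma> \<phi>"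
  shows "entails D \<Gamma> \<psi>"
proof (rule entails_OrE)
  have fm: "is_fm D \<phi>" "is_fm D \<psi>"
    using entails_is_fm[OF assms(1)] by simp_all
  show "entails D \<Gamma> (Or (Neg \<phi>) \<psi>)"
    using assms(1) by (simp add: Imp_def)
  show "entails D (insert (Neg \<phi>) \<Gamma>) \<psi>"
    using fm by (intro entails_contradiction[OF assms(2)]) auto
  show "entails D (insert \<psi> \<Gamma>) \<psi>"
    using fm by (intro entails_assumption) auto
qed

lemma entails_AndI:
  assumes "entails D \<Gamma> \<phi>" "entails D \<Gamma> \<psi>"
  shows "entails D \<Gamma> (And \<phi> \<psi>)"
proof -
  let ?n = "Or (Neg \<phi>) (Neg \<psi>)"
  have fm: "is_fm D \<phi>" "is_fm D \<psi>"
    using assms by (auto dest: entails_is_fm)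
  \<comment> \<open>With no introduction rule for negation, \<open>Neg ?n\<close> is proved by cases
    on \<open>?n\<close>: under \<open>?n\<close> each disjunct contradicts one of the conjuncts,
    and under \<open>Neg ?n\<close> it is a hypothesis.\<close>
  have 1: "entails D (insert (Neg \<phi>) (insert ?n \<Gamma>)) (Neg ?n)"
    using fm by (intro entails_contradiction[OF assms(1)]) auto
  have 2: "entails D (insert (Neg \<psi>) (insert ?n \<Gamma>)) (Neg ?n)"
    using fm by (intro entails_contradiction[OF assms(2)]) auto
  have "entails D (insert ?n \<Gamma>) ?n"
    using fm by (intro entails_assumption) auto
  from this 1 2 have "entails D (insert ?n \<Gamma>) (Neg ?n)"
    by (rule entails_OrE)
  moreover have "entails D (insert (Neg ?n) \<Gamma>) (Neg ?n)"
    using fm by (intro entails_assumption) auto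
  ultimately show ?thesis
    unfolding And_def using fm entails_by_cases[of D ?n] by simp
qed

text \<open>If the conjunct failed, the disjunction of the negations would follow, and
  \<open>And\<close> abbreviates the negation of exactly that disjunction.\<close>

lemma entails_AndE1:
  assumes "entails D \<Gamma> (And \<phi> \<psi>)"
  shows "entails D \<Gamma> \<phi>"
proof (rule entails_by_cases)
  have fm: "is_fm D \<phi>" "is_fm D \<psi>"
    using entails_is_fm[OF assms] by simp_all
  show "is_fm D \<phi>" by fact
  show "entails D (insert \<phi> \<Gamma>) \<phi>"
    using fm by (intro entails_assumption) auto
  have "entails D (insert (Neg \<phi>) \<Gamma>) (Or (Neg \<phi>) (Neg \<psi>))"
    using fm by (intro entails_OrI1 entails_assumption) auto
  moreover have "entails D (insert (Neg \<phi>) \<Gamma>) (Neg (Or (Neg \<phi>) (Neg \<psi>)))"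
    using assms unfolding And_def by (rule entails_mono) auto
  ultimately show "entails D (insert (Neg \<phi>) \<Gamma>) \<phi>"
    using fm entails_ex_falso by blast
qed

lemma entails_AndE2:
  assumes "entails D \<Gamma> (And \<phi> \<psi>)"
  shows "entails D \<Gamma> \<psi>"
proof (rule entails_by_cases)
  have fm: "is_fm D \<phi>" "is_fm D \<psi>"
    using entails_is_fm[OF assms] by simp_all
  show "is_fm D \<psi>" by fact
  show "entails D (insert \<psi> \<Gamma>) \<psi>"
    using fm by (intro entails_assumption) auto
  have "entails D (insert (Neg \<psi>) \<Gamma>) (Or (Neg \<phi>) (Neg \<psi>))"
    using fm by (intro entails_OrI2 entails_assumption) auto
  moreover have "entails D (insert (Neg \<psi>) \<Gamma>) (Neg (Or (Neg \<phi>) (Neg \<psi>)))"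
    using assms unfolding And_def by (rule entails_mono) auto
  ultimately show "entails D (insert (Neg \<psi>) \<Gamma>) \<psi>"
    using fm entails_ex_falso by blast
qed

lemma entails_ConjI: "(\<And>\<phi>. \<phi> \<in> set \<phi>s \<Longrightarrow> entails D \<Gamma> \<phi>) \<Longrightarrow> entails D \<Gamma> (Conj \<phi>s)"
proof (induction \<phi>s rule: Conj.induct)
  case 1
  then show ?case
    by (simp add: Top_def entails_excluded_middle)
qed (simp_all add: entails_AndI)

lemma entails_ConjE: "entails D \<Gamma> (Conj \<phi>s) \<Longrightarrow> \<phi> \<in> set \<phi>s \<Longrightarrow> entails D \<Gamma> \<phi>"
  by (induction \<phi>s rule: Conj.induct) (auto dest: entails_AndE1 entails_AndE2)

lemma entails_BigAndI:
  "finite A \<Longrightarrow> (\<And>a. a \<in> A \<Longrightarrow> entails D \<Gamma> (f a)) \<Longrightarrow> entails D \<Gamma> (BigAnd A f)"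
  unfolding BigAnd_def by (rule entails_ConjI) (auto simp: set_enum_set)

lemma entails_BigAndE: "finite A \<Longrightarrow> entails D \<Gamma> (BigAnd A f) \<Longrightarrow> a \<in> A \<Longrightarrow> entails D \<Gamma> (f a)"
  by (auto simp: BigAnd_def set_enum_set intro: entails_ConjE)

section \<open>Universal quantification over individuals\<close>

lemma entails_AllI_intro:
  assumes "entails D (ishift ` \<Gamma>) \<phi>"
  shows "entails D \<Gamma> (AllI \<phi>)"
proof -
  let ?e = "ExI (Neg \<phi>)"
  have fm: "is_fm D \<phi>"
    using assms by (rule entails_is_fm)
  \<comment> \<open>Refutes a supposed counterexample: its eigenvariable lives over the shifted
    context, where the premise derives \<phi> against \<open>Neg \<phi>\<close>.\<close>
  have "entails D (insert (Neg \<phi>) (ishift ` insert ?e \<Gamma>)) (ishift (Neg ?e))"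
    using fm by (intro entails_contradiction[OF assms] is_fm_ishift) auto
  moreover have "entails D (insert ?e \<Gamma>) ?e"
    using fm by (intro entails_assumption) auto
  ultimately have "entails D (insert ?e \<Gamma>) (Neg ?e)"
    using fm entails_ExI_elim by auto
  moreover have "entails D (insert (Neg ?e) \<Gamma>) (Neg ?e)"
    using fm by (intro entails_assumption) auto
  ultimately show ?thesis
    unfolding AllI_def using fm entails_by_cases[of D ?e] by simp
qed

lemma entails_AllI_elim:
  assumes "entails D \<Gamma> (AllI \<phi>)" "is_itm D t"
  shows "entails D \<Gamma> (iinst 0 t \<phi>)"
proof (rule entails_by_cases)
  have fm: "is_fm D \<phi>"
    using entails_is_fm[OF assms(1)] by simp
  then show fm': "is_fm D (iinst 0 t \<phi>)"
    using assms(2) by (rule is_fm_iinst)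
  show "entails D (insert (iinst 0 t \<phi>) \<Gamma>) (iinst 0 t \<phi>)"
    using fm' by (intro entails_assumption) auto
  have "entails D (insert (Neg (iinst 0 t \<phi>)) \<Gamma>) (iinst 0 t (Neg \<phi>))"
    using fm' by (intro entails_assumption) (auto simp: iinst_def)
  \<comment> \<open>If the instance at \<open>t\<close> failed, \<open>t\<close> would witness the
    existential formula that \<open>AllI\<close> negates.\<close>
  then have "entails D (insert (Neg (iinst 0 t \<phi>)) \<Gamma>) (ExI (Neg \<phi>))"
    using assms(2) fm by (intro entails_ExI_intro) auto
  moreover have "entails D (insert (Neg (iinst 0 t \<phi>)) \<Gamma>) (Neg (ExI (Neg \<phi>)))"
    using assms(1) by (auto simp: AllI_def intro: entails_mono)
  ultimately show "entails D (insert (Neg (iinst 0 t \<phi>)) \<Gamma>) (iinst 0 t \<phi>)"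
    using fm' by (rule entails_ex_falso)
qed

text \<open>Serves universal hypotheses that have moved into the scope of a fresh variable: that
  variable has index 0, and instantiating at it undoes the shift.\<close>

lemma entails_ishift_AllI:
  assumes "ishift (AllI \<phi>) \<in> \<Gamma>" "is_fm D \<phi>"
  shows "entails D \<Gamma> \<phi>"
proof -
  have "entails D \<Gamma> (ishift (AllI \<phi>))"
    using assms by (intro entails_assumption is_fm_ishift) auto
  then have "entails D \<Gamma> (iinst 0 (IVar 0) (isubst (iup (\<lambda>n. IVar (Suc n))) \<phi>))"
    by (intro entails_AllI_elim) (simp_all add: ishift_def)
  moreover have "(\<lambda>n. isubst_t (case_nat (IVar 0) IVar) (iup (\<lambda>n. IVar (Suc n)) n)) = IVar"
    by (rule ext) (simp add: iup_def split: nat.split)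
  ultimately show ?thesis
    by (simp add: iinst_def isubst_comp)
qed

lemma iup_case_nat:
  "iup (case_nat t \<sigma>) = case_nat (IVar 0) (case_nat (ishift_t t) (\<lambda>n. ishift_t (\<sigma> n)))"
  by (rule ext) (simp add: iup_def split: nat.split)

lemma isubst_t_case_nat:
  "isubst_t \<sigma> (case_nat t \<tau> n) = case_nat (isubst_t \<sigma> t) (\<lambda>n. isubst_t \<sigma> (\<tau> n)) n"
  by (simp split: nat.split)

text \<open>The outer quantifier binds index 1 of \<phi>, hence \<open>t\<close> comes second. The
  first instantiation shifts \<open>t\<close> past the inner binder, and the second cancels this
  shift.\<close>

lemma entails_AllI_elim2:
  assumes "entails D \<Gamma> (AllI (AllI \<phi>))" "is_itm D t" "is_itm D u"
  shows "entails D \<Gamma> (isubst (case_nat u (case_nat t IVar)) \<phi>)"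
proof -
  have "entails D \<Gamma> (AllI (isubst (iup (case_nat t IVar)) \<phi>))"
    using entails_AllI_elim[OF assms(1,2)] by (simp add: iinst_def)
  from entails_AllI_elim[OF this assms(3)] show ?thesis
    by (simp add: iinst_def isubst_comp iup_case_nat isubst_t_case_nat
        cong: nat.case_cong)
qed

section \<open>Equality and order\<close>

lemma entails_IEq_subst:
  assumes "entails D \<Gamma> (IEq t u)" "entails D \<Gamma> (iinst 0 t \<phi>)" "is_fm D \<phi>"
  shows "entails D \<Gamma> (iinst 0 u \<phi>)"
proof -
  \<comment> \<open>In the axiom z, y, x have indices 0, 1, 2, so a parameter \<open>Suc n\<close>
    of \<phi> has to become \<open>n + 3\<close>.\<close>
  let ?\<phi> = "iinst 3 (IVar 0) \<phi>"
  let ?ax = "AllI (AllI (Imp (IEq (IVar 1) (IVar 0))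
    (Imp (iinst 0 (IVar 1) ?\<phi>) (iinst 0 (IVar 0) ?\<phi>))))"
  have itm: "is_itm D t" "is_itm D u"
    using entails_is_fm[OF assms(1)] by simp_all
  have "entails D \<Gamma> ?ax"
    using assms(3) by (intro entails_axiom fso0_axiom.eq_subst) (auto intro!: is_fm_iinst)
  from entails_AllI_elim2[OF this itm]
  have "entails D \<Gamma> (Imp (IEq t u) (Imp (iinst 0 t \<phi>) (iinst 0 u \<phi>)))"
    by (simp add: iinst_def isubst_comp isubst_t_case_nat numeral_3_eq_3 cong: nat.case_cong)
  then show ?thesis
    using assms entails_mp by blast
qed

lemma entails_IEq_refl: "is_itm D t \<Longrightarrow> entails D \<Gamma> (IEq t t)"
  using entails_AllI_elim[OF entails_axiom[OF fso0_axiom.eq_refl], of D t \<Gamma>]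
  by (simp add: iinst_def)

lemma entails_IEq_sym:
  assumes "entails D \<Gamma> (IEq t u)"
  shows "entails D \<Gamma> (IEq u t)"
proof -
  have "is_itm D t"
    using entails_is_fm[OF assms] by simp
  \<comment> \<open>Rewrites along t = u in the formula z = t, which reflexivity proves for z = t;
    \<open>t\<close> is shifted to make room for z at index 0.\<close>
  with entails_IEq_subst[OF assms, of "IEq (IVar 0) (ishift_t t)"] show ?thesis
    by (simp add: iinst_def entails_IEq_refl)
qed

lemma entails_less_trans:
  assumes "entails D \<Gamma> (Less s t)" "entails D \<Gamma> (Less t u)"
  shows "entails D \<Gamma> (Less s u)"
proof -
  have itm: "is_itm D s" "is_itm D t" "is_itm D u"
    using entails_is_fm[OF assms(1)] entails_is_fm[OF assms(2)] by simp_all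
  have "entails D \<Gamma> (AllI (AllI (AllI (Imp (Less (IVar 2) (IVar 1))
      (Imp (Less (IVar 1) (IVar 0)) (Less (IVar 2) (IVar 0)))))))"
    by (rule entails_axiom[OF fso0_axiom.less_trans]) simp
  \<comment> \<open>One quantifier remains, so \<open>s\<close> and \<open>t\<close> stay shifted
    until it too is instantiated.\<close>
  from entails_AllI_elim2[OF this itm(1,2)]
  have "entails D \<Gamma> (AllI (Imp (Less (ishift_t s) (ishift_t t))
      (Imp (Less (ishift_t t) (IVar 0)) (Less (ishift_t s) (IVar 0)))))"
    by (simp add: iup_case_nat numeral_2_eq_2)
  from entails_AllI_elim[OF this itm(3)]
  have "entails D \<Gamma> (Imp (Less s t) (Imp (Less t u) (Less s u)))"
    by (simp add: iinst_def)
  then show ?thesis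
    using assms entails_mp by blast
qed

lemma entails_less_irrefl:
  assumes "entails D \<Gamma> (Less t t)" "is_fm D \<psi>"
  shows "entails D \<Gamma> \<psi>"
proof (rule entails_ex_falso)
  show "entails D \<Gamma> (ExI (Less (IVar 0) (IVar 0)))"
    using assms(1) entails_is_fm[OF assms(1)]
    by (intro entails_ExI_intro[of D \<Gamma> t]) (simp_all add: iinst_def)
  show "entails D \<Gamma> (Neg (ExI (Less (IVar 0) (IVar 0))))"
    by (rule entails_axiom[OF fso0_axiom.less_irrefl]) simp
qed fact

lemma entails_root_least:
  assumes "is_itm D t"
  shows "entails D \<Gamma> (Leq Root t)"
proof -
  have "entails D \<Gamma> (AllI (Leq Root (IVar 0)))"
    by (rule entails_axiom[OF fso0_axiom.root_least]) simp
  from entails_AllI_elim[OF this assms] show ?thesis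
    by (simp add: iinst_def)
qed

text \<open>As the root is least, either Root < t, and transitivity gives t < t, or Root = t, and
  rewriting gives t < t; irreflexivity refutes both.\<close>

lemma entails_less_Root:
  assumes "entails D \<Gamma> (Less t Root)" "is_fm D \<psi>"
  shows "entails D \<Gamma> \<psi>"
proof (rule entails_OrE)
  have t: "is_itm D t"
    using entails_is_fm[OF assms(1)] by simp
  show "entails D \<Gamma> (Or (Less Root t) (IEq Root t))"
    using entails_root_least[OF t] by (simp add: Leq_def)
  have "entails D (insert (Less Root t) \<Gamma>) (Less Root t)"
    using t by (intro entails_assumption) auto
  moreover have "entails D (insert (Less Root t) \<Gamma>) (Less t Root)"
    using assms(1) by (rule entails_mono) auto
  ultimately have "entails D (insert (Less Root t) \<Gamma>) (Less t t)"
    using entails_less_trans by blast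
  then show "entails D (insert (Less Root t) \<Gamma>) \<psi>"
    using assms(2) by (rule entails_less_irrefl)
  have "entails D (insert (IEq Root t) \<Gamma>) (IEq Root t)"
    using t by (intro entails_assumption) auto
  moreover have "entails D (insert (IEq Root t) \<Gamma>) (Less t Root)"
    using assms(1) by (rule entails_mono) auto
  \<comment> \<open>The root is replaced by \<open>t\<close> in the formula t < z, with z at index
    0.\<close>
  ultimately have "entails D (insert (IEq Root t) \<Gamma>) (Less t t)"
    using t entails_IEq_subst[of D _ Root t "Less (ishift_t t) (IVar 0)"]
    by (simp add: iinst_def)
  then show "entails D (insert (IEq Root t) \<Gamma>) \<psi>"
    using assms(2) by (rule entails_less_irrefl)
qed

lemma entails_less_SuccD:
  assumes "entails D \<Gamma> (Less t (Succ d u))"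
  shows "entails D \<Gamma> (Leq t u)"
proof -
  \<comment> \<open>The hypothesis is a formula of the language, so \<open>d\<close> is a direction
    in \<open>D\<close>; this makes its conjunct of the axiom available.\<close>
  have itm: "is_itm D t" "is_itm D u" and d: "d |\<in>| elts D"
    using entails_is_fm[OF assms] by simp_all
  have "entails D \<Gamma> (AllI (AllI (BigAnd (fset (elts D))
      (\<lambda>d. Iff (Less (IVar 1) (Succ d (IVar 0))) (Leq (IVar 1) (IVar 0))))))"
    by (rule entails_axiom[OF fso0_axiom.less_succ]) (auto intro: is_fm_BigAnd)
  from entails_AllI_elim2[OF this itm]
  have "entails D \<Gamma> (BigAnd (fset (elts D)) (\<lambda>d. Iff (Less t (Succ d u)) (Leq t u)))"
    by simp
  then have "entails D \<Gamma> (Iff (Less t (Succ d u)) (Leq t u))"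
    using d by (auto dest: entails_BigAndE[rotated])
  then show ?thesis
    unfolding Iff_def using assms entails_AndE1 entails_mp by blast
qed

section \<open>Well-founded induction\<close>

text \<open>The induction axiom as a rule. The step runs under a fresh x, hence the shifted context;
  offset 1 in \<open>iinst\<close> places \<phi>(S_d(x)) under that same binder.\<close>

lemma entails_induction:
  assumes "entails D \<Gamma> (iinst 0 Root \<phi>)"
    and "\<And>d. d |\<in>| elts D \<Longrightarrow> entails D (insert \<phi> (ishift ` \<Gamma>)) (iinst 1 (Succ d (IVar 0)) \<phi>)"
    and "is_fm D \<phi>"
  shows "entails D \<Gamma> (AllI \<phi>)"
proof -
  let ?steps = "BigAnd (fset (elts D)) (\<lambda>d. AllI (Imp \<phi> (iinst 1 (Succ d (IVar 0)) \<phi>)))"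
  have "entails D \<Gamma> ?steps"
    using assms(2,3) by (intro entails_BigAndI entails_AllI_intro entails_ImpI) auto
  moreover have "entails D \<Gamma> (Imp (iinst 0 Root \<phi>) (Imp ?steps (AllI \<phi>)))"
    using assms(3)
    by (intro entails_axiom fso0_axiom.induction) (auto intro!: is_fm_iinst is_fm_BigAnd)
  ultimately show ?thesis
    using assms(1) entails_mp by blast
qed

theorem theorem3p9:
  fixes D :: hf and \<phi> :: fm
  assumes "elts D \<noteq> {||}"
    and "is_fm D \<phi>"
  shows "fso0 D []
    (Imp (AllI (Imp (AllI (Imp (Less (IVar 0) (IVar 1)) (iinst 2 (IVar 0) \<phi>))) \<phi>))
      (AllI \<phi>))"
proof -
  \<comment> \<open>\<phi>(y) below the binders of x and y: y has index 0, x has index 1, and each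
    parameter \<open>Suc n\<close> moves to \<open>n + 2\<close>.\<close>
  define \<phi>' where "\<phi>' = iinst 2 (IVar 0) \<phi>"
  define \<psi> where "\<psi> = AllI (Imp (Less (IVar 0) (IVar 1)) \<phi>')"
  let ?H = "AllI (Imp \<psi> \<phi>)"
  have fm': "is_fm D \<phi>'"
    unfolding \<phi>'_def using assms(2) by (simp add: is_fm_iinst)
  then have fm\<psi>: "is_fm D \<psi>"
    by (simp add: \<psi>_def)
  \<comment> \<open>General in \<open>j\<close> and \<open>t\<close> to serve the root and the
    successor alike; the quantifier inside \<psi> turns \<open>j\<close> into
    \<open>Suc j\<close>.\<close>
  have iinst_\<psi>: "iinst j t \<psi> = AllI (Imp (Less (IVar 0) (ishift_t t)) (iinst (Suc j) (IVar 0) \<phi>))"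
    for j t
  proof -
    have "(\<lambda>n. isubst_t (iup (case_nat t (\<lambda>n. IVar (n + j))))
          (case_nat (IVar 0) (\<lambda>n. IVar (Suc (Suc n))) n))
        = case_nat (IVar 0) (\<lambda>n. IVar (n + Suc j))"
      by (rule ext) (simp split: nat.split)
    then show ?thesis
      by (simp add: \<psi>_def \<phi>'_def iinst_def isubst_comp)
  qed
  have \<psi>_Root: "iinst 0 Root \<psi> = AllI (Imp (Less (IVar 0) Root) \<phi>)"
  proof -
    \<comment> \<open>At offset 1 every index returns to its place, so this instance of \<phi> is
      \<phi> itself.\<close>
    have "case_nat (IVar 0) (\<lambda>n. IVar (n + 1)) = IVar"
      by (rule ext) (simp split: nat.split)
    then show ?thesis
      by (simp add: iinst_\<psi>) (simp add: iinst_def)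
  qed
  have \<psi>_Succ: "iinst 1 (Succ d (IVar 0)) \<psi> = AllI (Imp (Less (IVar 0) (Succ d (IVar 1))) \<phi>')"
    for d
    by (simp add: iinst_\<psi> \<phi>'_def numeral_2_eq_2)
  \<comment> \<open>Progressiveness at the current x: once \<psi>(x) is assumed, \<phi>(x)
    follows.\<close>
  have H_elim: "entails D (insert \<psi> (ishift ` {?H})) \<phi>"
  proof -
    have "entails D (insert \<psi> (ishift ` {?H})) (Imp \<psi> \<phi>)"
      using assms(2) fm\<psi> by (intro entails_ishift_AllI) auto
    then show ?thesis
      by (rule entails_mp) (use fm\<psi> in \<open>auto intro: entails_assumption\<close>)
  qed
  have "entails D {?H} (AllI \<psi>)"
  proof (rule entails_induction)
    \<comment> \<open>The base case is vacuous: y < Root entails any formula.\<close>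
    have "entails D {Less (IVar 0) Root} \<phi>"
      using assms(2) by (auto intro: entails_less_Root[OF entails_assumption])
    then show "entails D {?H} (iinst 0 Root \<psi>)"
      unfolding \<psi>_Root by (intro entails_AllI_intro entails_ImpI) (auto intro: entails_mono)
  next
    fix d
    assume d: "d |\<in>| elts D"
    let ?l = "Less (IVar 0) (Succ d (IVar 1))"
    \<comment> \<open>The context of the step, shifted once more for a fresh y; now y has index 0, x
      has index 1, and \<open>ishift \<phi>\<close> is \<phi>(x).\<close>
    let ?\<Gamma> = "ishift ` insert \<psi> (ishift ` {?H})"
    let ?\<Delta> = "insert ?l (insert (ishift \<phi>) ?\<Gamma>)"
    have "entails D ?\<Delta> \<phi>'"
    proof (rule entails_OrE)
      have "entails D ?\<Delta> ?l"
        using d by (intro entails_assumption) auto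
      then show "entails D ?\<Delta> (Or (Less (IVar 0) (IVar 1)) (IEq (IVar 0) (IVar 1)))"
        unfolding Leq_def[symmetric] by (rule entails_less_SuccD)
      let ?\<Delta>1 = "insert (Less (IVar 0) (IVar 1)) ?\<Delta>"
      \<comment> \<open>Case y < x: the shifted induction hypothesis \<psi>(x) is instantiated at
        y.\<close>
      have "entails D ?\<Delta>1 (Imp (Less (IVar 0) (IVar 1)) \<phi>')"
        using fm' by (intro entails_ishift_AllI) (auto simp: \<psi>_def)
      then show "entails D ?\<Delta>1 \<phi>'"
        by (rule entails_mp) (auto intro: entails_assumption)
      let ?\<Delta>2 = "insert (IEq (IVar 0) (IVar 1)) ?\<Delta>"
      \<comment> \<open>Case y = x: a template with a hole at index 0, giving \<phi>(x) when filled
        with index 1 and \<phi>(y) when filled with index 0.\<close>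
      let ?\<chi> = "iinst 3 (IVar 0) \<phi>"
      have \<chi>: "iinst 0 (IVar 1) ?\<chi> = ishift \<phi>" "iinst 0 (IVar 0) ?\<chi> = \<phi>'"
      proof -
        have "case_nat (IVar (Suc 0)) (\<lambda>n. IVar (Suc (Suc n))) = (\<lambda>n. IVar (Suc n))"
          by (rule ext) (simp split: nat.split)
        then show "iinst 0 (IVar 1) ?\<chi> = ishift \<phi>" "iinst 0 (IVar 0) ?\<chi> = \<phi>'"
          by (simp_all add: \<phi>'_def ishift_def iinst_def isubst_comp isubst_t_case_nat numeral_3_eq_3 cong: nat.case_cong)
      qed
      have "entails D ?\<Delta>2 (IEq (IVar 0) (IVar 1))"
        by (intro entails_assumption) auto
      \<comment> \<open>Rewriting carries \<phi>(x) to \<phi>(y), so the equation is needed from x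
        to y.\<close>
      then have "entails D ?\<Delta>2 (IEq (IVar 1) (IVar 0))"
        by (rule entails_IEq_sym)
      moreover have "entails D ?\<Delta>2 (iinst 0 (IVar 1) ?\<chi>)"
        unfolding \<chi> using assms(2) by (intro entails_assumption is_fm_ishift) auto
      ultimately show "entails D ?\<Delta>2 \<phi>'"
        unfolding \<chi>(2)[symmetric]
        by (rule entails_IEq_subst) (use assms(2) in \<open>simp add: is_fm_iinst\<close>)
    qed
    then have "entails D (insert (ishift \<phi>) ?\<Gamma>) (Imp ?l \<phi>')"
      using d by (intro entails_ImpI) auto
    then have "entails D (insert \<phi> (insert \<psi> (ishift ` {?H}))) (iinst 1 (Succ d (IVar 0)) \<psi>)"
      unfolding \<psi>_Succ by (intro entails_AllI_intro) simp
    \<comment> \<open>The extra hypothesis \<phi>(x) is discharged here and then supplied by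
      \<open>H_elim\<close>.\<close>
    then have "entails D (insert \<psi> (ishift ` {?H})) (Imp \<phi> (iinst 1 (Succ d (IVar 0)) \<psi>))"
      using assms(2) by (rule entails_ImpI)
    then show "entails D (insert \<psi> (ishift ` {?H})) (iinst 1 (Succ d (IVar 0)) \<psi>)"
      using H_elim by (rule entails_mp)
  qed (rule fm\<psi>)
  \<comment> \<open>Under a fresh x, both \<psi>(x) and progressiveness at x are available, which
    gives \<phi>(x).\<close>
  moreover have "entails D {?H} (Imp (AllI \<psi>) (AllI \<phi>))"
  proof (intro entails_ImpI entails_AllI_intro)
    let ?\<Gamma> = "ishift ` insert (AllI \<psi>) {?H}"
    have "entails D ?\<Gamma> (Imp \<psi> \<phi>)"
      using assms(2) fm\<psi> by (intro entails_ishift_AllI) auto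
    moreover have "entails D ?\<Gamma> \<psi>"
      using fm\<psi> by (intro entails_ishift_AllI) auto
    ultimately show "entails D ?\<Gamma> \<phi>"
      by (rule entails_mp)
  qed (use fm\<psi> in simp)
  ultimately have "entails D {?H} (AllI \<phi>)"
    using entails_mp by blast
  then have "entails D {} (Imp ?H (AllI \<phi>))"
    using assms(2) fm\<psi> by (intro entails_ImpI) auto
  then show ?thesis
    by (simp add: entails_def \<psi>_def \<phi>'_def)
qed

end
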